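(* Let $\mathfrak{g}_2^c=R^\sigma[G^\times]$ be the real Lie algebra with the bracket described in the context. Then $\{(4,0)g_i,(0,4)g_i : i=1,\dots,7\}$ is an orthogonal basis of $\mathfrak{g}_2^c$ (with respect to the Killing form) consisting of semisimple elements, with integer structure constants. More precisely, the complete table of products is the following, for all $i\in\{1,\dots,7\}$ and $a,b\in\mathbb{R}$ (indices modulo 7), where the entry in the row of $y$ and the column of $\mathrm{ad}(x)$ is $\mathrm{ad}(x)(y)=[x,y]$: $$\begin{array}{l|c|c|} &\mathrm{ad}((1,0)g_i)&\mathrm{ad}((0,1)g_i)\\\hline (a,b)g_{i}&0&0\\ (a,b)g_{i+1}&\frac14(a+3b,\,-a-3b)\,g_{i+3}&\frac14(3b-3a,\,b-a)\,g_{i+3}\\ (a,b)g_{i+2}&\frac14(a-3b,\,-a-b)\,g_{i+6}&\frac14(3a-9b,\,a+b)\,g_{i+6}\\ (a,b)g_{i+3}&\frac14(3b-a,\,3b-a)\,g_{i+1}&\frac14(3a+3b,\,-a-b)\,g_{i+1}\\ (a,b)g_{i+4}&\frac14(a-3b,\,a+b)\,g_{i+5}&\frac14(-3a-3b,\,b-3a)\,g_{i+5}\\ (a,b)g_{i+5}&\frac14(-a-3b,\,a-b)\,g_{i+4}&\frac14(3a+9b,\,a-b)\,g_{i+4}\\ (a,b)g_{i+6}&\frac14(3b-a,\,a+b)\,g_{i+2}&\frac14(-3a-3b,\,3a-b)\,g_{i+2}\\\hline \end{array}$$ Also, $\{\frac12(1,0)g_i,\ \frac1{2\sqrt3}(0,1)g_i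 : i=1,\dots,7\}$ is an orthonormal basis of $\mathfrak{g}_2^c$ for the Killing form $\kappa$, in the sense that distinct elements are orthogonal and each element $x$ has norm $\kappa(x,x)=-1$; it consists of semisimple elements and has structure constants in $\mathbb{Q}[\sqrt3]$.
   Context: The elements of $G=\mathbb{Z}_2^3$ are denoted $g_0=(\bar0,\bar0,\bar0)$, $g_1=(\bar1,\bar0,\bar0)$, $g_2=(\bar0,\bar1,\bar0)$, $g_3=(\bar0,\bar0,\bar1)$, $g_4=(\bar1,\bar1,\bar0)$, $g_5=(\bar0,\bar1,\bar1)$, $g_6=(\bar1,\bar1,\bar1)$, $g_7=(\bar1,\bar0,\bar1)$, so that $g_i+g_{i+1}=g_{i+3}$ for $i\in\{1,\dots,7\}$, where indices are taken modulo 7 with representatives in $\{1,\dots,7\}$; $G^\times=G\setminus\{g_0\}$. Let $R=\mathbb{R}\oplus\mathbb{R}$ with component-wise product $(a,b)*(a',b')=(aa',bb')$; elements of $R$ are regarded as row vectors on which $2\times 2$ matrices act by right multiplication. Let $P=\frac12\begin{pmatrix}1&1\\3&-1\end{pmatrix}$ and $\theta=\begin{pmatrix}-1&0\\0&1\end{pmatrix}$. The real vector space $R^\sigma[G^\times]=\{\sum_{i=1}^7 r_ig_i : r_i\in R\}$ (free $R$-module on the $g_i$, real dimension 14) has the bilinear product given by $[rg_i,r'g_i]=0$ and, for $i\ne j$, $[rg_i,r'g_j]=\sigma_{ij}(r,r')(g_i+g_j)$ (with $g_i+g_j$ the sum in $G$), where $\sigma_{ij}(r,r')=-\sigma_{ji}(r',r)$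 and, for all $i$ (indices modulo 7), $$\sigma_{i,i+1}(r,r')=(r*(r'P))\theta P\theta,\quad \sigma_{i,i+2}(r,r')=((rP)*(r'\theta P))\theta,\quad \sigma_{i,i+4}(r,r')=((r\theta P)*r')\theta P .$$ This algebra is a model of the compact real simple Lie algebra $\mathfrak{g}_2^c$ of type $G_2$. The Killing form is $\kappa(x,y)=\mathrm{tr}(\mathrm{ad}(x)\,\mathrm{ad}(y))$. An element $x$ is semisimple if $\mathrm{ad}(x)$ is a semisimple endomorphism (diagonalizable over $\mathbb{C}$). The structure constants of a basis are the coefficients of the brackets of basis elements expressed in that basis. *)

theory Defs
  imports "HOL-Analysis.Analysis" "HOL-Library.Z2"
begin

text \<open>Indices live in the type 7 of residues modulo 7, so that index arithmetic is modulo 7 by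
  construction. The residue of 7 is \<open>0 :: 7\<close>; the neutral element of the group is
  \<open>0 :: bit^3\<close> and is not in the range of \<open>g\<close>.\<close>

definition g :: "7 \<Rightarrow> bit^3" where
  "g i = (if i = 1 then vector [1, 0, 0]
     else if i = 2 then vector [0, 1, 0]
     else if i = 3 then vector [0, 0, 1]
     else if i = 4 then vector [1, 1, 0]
     else if i = 5 then vector [0, 1, 1]
     else if i = 6 then vector [1, 1, 1]
     else vector [1, 0, 1])"

text \<open>The product \<open>*\<close> of \<open>real^2\<close> is the component-wise one.\<close>

type_synonym R = "real^2"

abbreviation R2 :: "real \<Rightarrow> real \<Rightarrow> R" where
  "R2 a b \<equiv> vector [a, b]"

definition P :: "real^2^2" where
  "P = (1/2) *\<^sub>R vector [vector [1, 1], vector [3, -1]]"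

definition \<theta> :: "real^2^2" where
  "\<theta> = vector [vector [-1, 0], vector [0, 1]]"

text \<open>The map \<open>\<sigma>\<^sub>i\<^sub>j\<close> depends only on the residue \<open>j - i\<close>; it is given
  by \<open>\<sigma>0\<close> for the residues 1, 2, 4, and by skew-symmetry for 3, 5, 6.\<close>

definition \<sigma>0 :: "7 \<Rightarrow> R \<Rightarrow> R \<Rightarrow> R" where
  "\<sigma>0 d r s =
     (if d = 1 then (r * (s v* P)) v* \<theta> v* P v* \<theta>
      else if d = 2 then ((r v* P) * (s v* \<theta> v* P)) v* \<theta>
      else if d = 4 then ((r v* \<theta> v* P) * s) v* \<theta> v* P
      else 0)"

definition \<sigma> :: "7 \<Rightarrow> 7 \<Rightarrow> R \<Rightarrow> R \<Rightarrow> R" where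
  "\<sigma> i j r s = (if j - i \<in> {1, 2, 4} then \<sigma>0 (j - i) r s else - \<sigma>0 (i - j) s r)"

text \<open>The element \<open>\<Sum>\<^sub>i r\<^sub>i g\<^sub>i\<close> of the algebra is represented by its family of
  coefficients \<open>\<chi> i. r\<^sub>i\<close>.\<close>

type_synonym g2c = "R^7"

abbreviation monom_g :: "R \<Rightarrow> 7 \<Rightarrow> g2c"  (infix "\<cdot>g" 75) where
  "r \<cdot>g i \<equiv> axis i r"

definition bracket :: "g2c \<Rightarrow> g2c \<Rightarrow> g2c" where
  "bracket x y = (\<chi> k. \<Sum>(i, j) | i \<noteq> j \<and> g i + g j = g k. \<sigma> i j (x $ i) (y $ j))"

definition ad :: "g2c \<Rightarrow> g2c \<Rightarrow> g2c" where
  "ad x = (\<lambda>y. bracket x y)"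

text \<open>The matrix of an endomorphism with respect to the real basis consisting of the
  \<open>(1,0)g\<^sub>i\<close> and \<open>(0,1)g\<^sub>i\<close>.\<close>

definition endo_matrix :: "(g2c \<Rightarrow> g2c) \<Rightarrow> real^(7 \<times> 2)^(7 \<times> 2)" where
  "endo_matrix f = (\<chi> p q. f (axis (fst q) (axis (snd q) 1)) $ fst p $ snd p)"

definition killing :: "g2c \<Rightarrow> g2c \<Rightarrow> real" where
  "killing x y = trace (endo_matrix (ad x \<circ> ad y))"

definition diagonalizable :: "'a::field^'n^'n \<Rightarrow> bool" where
  "diagonalizable A \<longleftrightarrow>
     (\<exists>(Q :: 'a^'n^'n) D. invertible Q \<and> (\<forall>i j. i \<noteq> j \<longrightarrow> D $ i $ j = 0) \<and> A = Q ** D ** matrix_inv Q)"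

definition semisimple :: "g2c \<Rightarrow> bool" where
  "semisimple x \<longleftrightarrow>
     diagonalizable ((\<chi> p q. complex_of_real (endo_matrix (ad x) $ p $ q)) :: complex^(7 \<times> 2)^(7 \<times> 2))"

definition is_basis :: "g2c set \<Rightarrow> bool" where
  "is_basis B \<longleftrightarrow> independent B \<and> span B = UNIV"

definition structure_constants :: "g2c set \<Rightarrow> real set" where
  "structure_constants B =
     {representation B (bracket x y) z | x y z. x \<in> B \<and> y \<in> B \<and> z \<in> B}"

definition Rats_sqrt3 :: "real set" where
  "Rats_sqrt3 = {p + q * sqrt 3 | p q. p \<in> \<rat> \<and> q \<in> \<rat>}"

lemma forall_7: "(\<forall>i::7. Q i) \<longleftrightarrow> Q 1 \<and> Q 2 \<and> Q 3 \<and> Q 4 \<and> Q 5 \<and> Q 6 \<and> Q 0"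
proof -
  have "\<exists>m::int. 0 \<le> m \<and> m < 7 \<and> i = of_int m" for i :: 7
    by (induction i rule: bit1_induct) auto
  then have "i = 1 \<or> i = 2 \<or> i = 3 \<or> i = 4 \<or> i = 5 \<or> i = 6 \<or> i = 0" for i :: 7
  proof -
    obtain m::int where m: "0 \<le> m" "m < 7" "i = of_int m"
      using \<open>\<And>i::7. \<exists>m::int. 0 \<le> m \<and> m < 7 \<and> i = of_int m\<close> by blast
    then have "m = 0 \<or> m = 1 \<or> m = 2 \<or> m = 3 \<or> m = 4 \<or> m = 5 \<or> m = 6" by arith
    with m show ?thesis by auto
  qed
  then show ?thesis by metis
qed

lemma UNIV_7: "(UNIV :: 7 set) = {1, 2, 3, 4, 5, 6, 0}"
  using forall_7[of "\<lambda>i. i \<in> {1, 2, 3, 4, 5, 6, 0}"] by auto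

lemma g_add: "g i + g (i + 1) = g (i + 3)"
proof -
  have "\<forall>i. g i + g (i + 1) = g (i + 3)"
    unfolding forall_7 by (simp add: g_def vec_eq_iff forall_3)
  then show ?thesis ..
qed

lemma bij_g: "bij_betw g UNIV (UNIV - {0})"
proof -
  have bit3: "\<exists>a b c. v = vector [a, b, c]" for v :: "bit^3"
    by (rule exI[of _ "v $ 1"], rule exI[of _ "v $ 2"], rule exI[of _ "v $ 3"])
       (simp add: vec_eq_iff forall_3)
  have b2: "a = 0 \<or> a = 1" for a :: bit
    by (cases a) auto
  have "\<forall>i j. g i = g j \<longrightarrow> i = j"
    unfolding forall_7 by (simp add: g_def vec_eq_iff forall_3)
  then have "inj g" by (auto simp: inj_on_def)
  moreover have "\<forall>i. g i \<noteq> 0"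
    unfolding forall_7 by (simp add: g_def vec_eq_iff forall_3)
  moreover have "v \<in> range g" if v: "v \<noteq> 0" for v
  proof -
    obtain a b c where "v = vector [a, b, c]" using bit3 by blast
    moreover have "vector [0, 0, 0] = (0 :: bit^3)" by (simp add: vec_eq_iff forall_3)
    ultimately have "v = g 1 \<or> v = g 2 \<or> v = g 3 \<or> v = g 4 \<or> v = g 5 \<or> v = g 6 \<or> v = g 0"
      using v b2[of a] b2[of b] b2[of c] by (auto simp: g_def)
    then show ?thesis by blast
  qed
  ultimately show ?thesis by (auto simp: bij_betw_def)
qed

lemma \<sigma>_zero [simp]: "\<sigma> i j 0 s = 0" "\<sigma> i j r 0 = 0"
  by (auto simp: \<sigma>_def \<sigma>0_def)

lemma \<sigma>_skew:
  assumes "i \<noteq> j"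
  shows "\<sigma> i j r s = - \<sigma> j i s r"
proof -
  have "\<forall>d::7. d \<noteq> 0 \<longrightarrow> (d \<in> {1,2,4} \<longleftrightarrow> - d \<notin> {1,2,4})"
    unfolding forall_7 by simp
  then have "i - j \<in> {1,2,4} \<longleftrightarrow> j - i \<notin> {1,2,4}"
    using assms by (metis minus_diff_eq right_minus_eq)
  then show ?thesis unfolding \<sigma>_def by auto
qed

lemma bracket_monom:
  "bracket (r \<cdot>g i) (s \<cdot>g i) = 0"
  "i \<noteq> j \<Longrightarrow> g k = g i + g j \<Longrightarrow> bracket (r \<cdot>g i) (s \<cdot>g j) = \<sigma> i j r s \<cdot>g k"
proof -
  have *: "(\<Sum>(i', j') | i' \<noteq> j' \<and> g i' + g j' = g k. \<sigma> i' j' ((r \<cdot>g i) $ i') ((s \<cdot>g j) $ j')) =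
     (if i \<noteq> j \<and> g i + g j = g k then \<sigma> i j r s else 0)" for i j k
  proof -
    have "(\<Sum>(i', j') | i' \<noteq> j' \<and> g i' + g j' = g k. \<sigma> i' j' ((r \<cdot>g i) $ i') ((s \<cdot>g j) $ j')) =
        (\<Sum>p | fst p \<noteq> snd p \<and> g (fst p) + g (snd p) = g k. if p = (i, j) then \<sigma> i j r s else 0)"
      by (rule sum.cong) (auto simp: axis_def split: if_splits)
    then show ?thesis by (simp add: sum.delta)
  qed
  show "bracket (r \<cdot>g i) (s \<cdot>g i) = 0"
    unfolding bracket_def * by (simp add: vec_eq_iff)
  assume "i \<noteq> j" "g k = g i + g j"
  moreover have "g k = g l \<longleftrightarrow> k = l" for l
    using bij_g by (metis UNIV_I bij_betw_def inj_on_def)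
  ultimately show "bracket (r \<cdot>g i) (s \<cdot>g j) = \<sigma> i j r s \<cdot>g k"
    unfolding bracket_def * by (auto simp: vec_eq_iff axis_def)
qed

lemma \<sigma>_add: "\<sigma> i j (r + r') s = \<sigma> i j r s + \<sigma> i j r' s" "\<sigma> i j r (s + s') = \<sigma> i j r s + \<sigma> i j r s'"
  and \<sigma>_scale: "\<sigma> i j (c *\<^sub>R r) s = c *\<^sub>R \<sigma> i j r s" "\<sigma> i j r (c *\<^sub>R s) = c *\<^sub>R \<sigma> i j r s"
  by (simp_all add: \<sigma>_def \<sigma>0_def vec_eq_iff forall_2 vector_matrix_mult_def sum_2 algebra_simps)

lemma bilinear_bracket: "bilinear bracket"
  unfolding bilinear_def
  by (auto intro!: linearI simp: bracket_def vec_eq_iff \<sigma>_add \<sigma>_scale sum.distrib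
     case_prod_unfold scaleR_sum_right sum_distrib_left)

lemma bracket_component:
  "bracket x y $ k =
      \<sigma>0 1 (x $ (k+4)) (y $ (k+5)) - \<sigma>0 1 (y $ (k+4)) (x $ (k+5)) +
      \<sigma>0 2 (x $ (k+1)) (y $ (k+3)) - \<sigma>0 2 (y $ (k+1)) (x $ (k+3)) +
      \<sigma>0 4 (x $ (k+2)) (y $ (k+6)) - \<sigma>0 4 (y $ (k+2)) (x $ (k+6))"
proof -
  have "\<forall>k i j. i \<noteq> j \<and> g i + g j = g k \<longleftrightarrow> (i, j) \<in> {(k+4, k+5), (k+5, k+4), (k+1, k+3), (k+3, k+1), (k+2, k+6), (k+6,k+2)}"
    unfolding forall_7 by (simp add: g_def vec_eq_iff forall_3)
  then have "{(i, j). i \<noteq> j \<and> g i + g j = g k} = {(k+4, k+5), (k+5, k+4), (k+1, k+3), (k+3, k+1), (k+2, k+6), (k+6,k+2)}"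
    by auto
  then show ?thesis by (simp add: bracket_def \<sigma>_def)
qed

lemma bracket_alt: "bracket x x = 0"
  by (simp add: vec_eq_iff bracket_component)

end

theory Submission
  imports Defs
begin

text \<open>
  All assertions follow from the table of products. The Killing form pairs distinct monomials
  \<open>r g\<^sub>i\<close>, \<open>s g\<^sub>j\<close> to zero because \<open>ad (r g\<^sub>i) \<circ> ad (s g\<^sub>j)\<close> shifts the grading by
  \<open>g\<^sub>i + g\<^sub>j \<noteq> 0\<close>. For semisimplicity, one reads off from the table that the endomorphisms
  \<open>ad ((c,0)g\<^sub>i)\<close> and \<open>ad ((0,c)g\<^sub>i)\<close> are annihilated by
  \<open>T (T\<^sup>2 + c\<^sup>2/4) (T\<^sup>2 + c\<^sup>2) (T\<^sup>2 + 9c\<^sup>2/4)\<close>, which has simple roots in the complex numbers.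
\<close>

section \<open>The table of products\<close>

text \<open>The translates of \<open>{0, 1, 3}\<close> modulo 7 are the lines of the Fano plane.
  These six sums are the three lines through \<open>i\<close>, each read from both of its other
  points, and so cover every nonzero offset of the second index.\<close>

lemma g_sum_shift:
  "g i + g (i + 1) = g (i + 3)" "g i + g (i + 2) = g (i + 6)" "g i + g (i + 3) = g (i + 1)"
  "g i + g (i + 4) = g (i + 5)" "g i + g (i + 5) = g (i + 4)" "g i + g (i + 6) = g (i + 2)"
proof -
  have "\<forall>i. g i + g (i + 1) = g (i + 3) \<and> g i + g (i + 2) = g (i + 6) \<and> g i + g (i + 3) = g (i + 1)
    \<and> g i + g (i + 4) = g (i + 5) \<and> g i + g (i + 5) = g (i + 4) \<and> g i + g (i + 6) = g (i + 2)"
    unfolding forall_7 by (simp add: g_def vec_eq_iff forall_3)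
  then show
    "g i + g (i + 1) = g (i + 3)" "g i + g (i + 2) = g (i + 6)" "g i + g (i + 3) = g (i + 1)"
    "g i + g (i + 4) = g (i + 5)" "g i + g (i + 5) = g (i + 4)" "g i + g (i + 6) = g (i + 2)"
    by blast+
qed

text \<open>Both columns of the table are merged into one formula linear in \<open>p\<close> and
  \<open>q\<close>. Once the factor 1/4 is absorbed, each output is again some \<open>R2\<close>
  coefficient at an offset from \<open>i\<close>, so iterated brackets with monomials at
  \<open>i\<close> on the left are evaluated by rewriting alone.\<close>

lemma bracket_table:
  fixes p q a b :: real
  shows
  "bracket (R2 p q \<cdot>g i) (R2 a b \<cdot>g i) = 0"
  "bracket (R2 p q \<cdot>g i) (R2 a b \<cdot>g (i + 1)) =
     ((1/4) *\<^sub>R R2 (p * (a + 3 * b) + q * (3 * b - 3 * a)) (p * (- a - 3 * b) + q * (b - a))) \<cdot>g (i + 3)"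
  "bracket (R2 p q \<cdot>g i) (R2 a b \<cdot>g (i + 2)) =
     ((1/4) *\<^sub>R R2 (p * (a - 3 * b) + q * (3 * a - 9 * b)) (p * (- a - b) + q * (a + b))) \<cdot>g (i + 6)"
  "bracket (R2 p q \<cdot>g i) (R2 a b \<cdot>g (i + 3)) =
     ((1/4) *\<^sub>R R2 (p * (3 * b - a) + q * (3 * a + 3 * b)) (p * (3 * b - a) + q * (- a - b))) \<cdot>g (i + 1)"
  "bracket (R2 p q \<cdot>g i) (R2 a b \<cdot>g (i + 4)) =
     ((1/4) *\<^sub>R R2 (p * (a - 3 * b) + q * (- 3 * a - 3 * b)) (p * (a + b) + q * (b - 3 * a))) \<cdot>g (i + 5)"
  "bracket (R2 p q \<cdot>g i) (R2 a b \<cdot>g (i + 5)) =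
     ((1/4) *\<^sub>R R2 (p * (- a - 3 * b) + q * (3 * a + 9 * b)) (p * (a - b) + q * (a - b))) \<cdot>g (i + 4)"
  "bracket (R2 p q \<cdot>g i) (R2 a b \<cdot>g (i + 6)) =
     ((1/4) *\<^sub>R R2 (p * (3 * b - a) + q * (- 3 * a - 3 * b)) (p * (a + b) + q * (3 * a - b))) \<cdot>g (i + 2)"
proof -
  \<comment> \<open>Offsets 1, 2, 4 use the defining formulas; 6, 5, 3 are their negatives modulo 7
    and go through skew-symmetry.\<close>
  have eq: "bracket (r \<cdot>g i) (s \<cdot>g (i + d)) = t \<cdot>g (i + e)"
    if "d \<noteq> 0" "g i + g (i + d) = g (i + e)"
      "t = (if d \<in> {1, 2, 4} then \<sigma>0 d r s else - \<sigma>0 (- d) s r)" for r s t d e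
    using that by (simp add: bracket_monom(2) \<sigma>_def del: insert_iff)
  note defs = \<sigma>0_def P_def \<theta>_def vec_eq_iff forall_2 vector_matrix_mult_def sum_2 field_simps
  show "bracket (R2 p q \<cdot>g i) (R2 a b \<cdot>g i) = 0"
    by (rule bracket_monom)
  show "bracket (R2 p q \<cdot>g i) (R2 a b \<cdot>g (i + 1)) =
     ((1/4) *\<^sub>R R2 (p * (a + 3 * b) + q * (3 * b - 3 * a)) (p * (- a - 3 * b) + q * (b - a))) \<cdot>g (i + 3)"
    by (rule eq[OF _ g_sum_shift(1)]) (simp_all add: defs)
  show "bracket (R2 p q \<cdot>g i) (R2 a b \<cdot>g (i + 2)) =
     ((1/4) *\<^sub>R R2 (p * (a - 3 * b) + q * (3 * a - 9 * b)) (p * (- a - b) + q * (a + b))) \<cdot>g (i + 6)"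
    by (rule eq[OF _ g_sum_shift(2)]) (simp_all add: defs)
  show "bracket (R2 p q \<cdot>g i) (R2 a b \<cdot>g (i + 3)) =
     ((1/4) *\<^sub>R R2 (p * (3 * b - a) + q * (3 * a + 3 * b)) (p * (3 * b - a) + q * (- a - b))) \<cdot>g (i + 1)"
    by (rule eq[OF _ g_sum_shift(3)]) (simp_all add: defs)
  show "bracket (R2 p q \<cdot>g i) (R2 a b \<cdot>g (i + 4)) =
     ((1/4) *\<^sub>R R2 (p * (a - 3 * b) + q * (- 3 * a - 3 * b)) (p * (a + b) + q * (b - 3 * a))) \<cdot>g (i + 5)"
    by (rule eq[OF _ g_sum_shift(4)]) (simp_all add: defs)
  show "bracket (R2 p q \<cdot>g i) (R2 a b \<cdot>g (i + 5)) =
     ((1/4) *\<^sub>R R2 (p * (- a - 3 * b) + q * (3 * a + 9 * b)) (p * (a - b) + q * (a - b))) \<cdot>g (i + 4)"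
    by (rule eq[OF _ g_sum_shift(5)]) (simp_all add: defs)
  show "bracket (R2 p q \<cdot>g i) (R2 a b \<cdot>g (i + 6)) =
     ((1/4) *\<^sub>R R2 (p * (3 * b - a) + q * (- 3 * a - 3 * b)) (p * (a + b) + q * (3 * a - b))) \<cdot>g (i + 2)"
    by (rule eq[OF _ g_sum_shift(6)]) (simp_all add: defs)
qed

lemma index_shift_cases:
  fixes i j :: 7
  obtains "j = i" | "j = i + 1" | "j = i + 2" | "j = i + 3" | "j = i + 4" | "j = i + 5" | "j = i + 6"
proof -
  have "\<forall>d::7. d \<in> {0, 1, 2, 3, 4, 5, 6}"
    unfolding forall_7 by simp
  then have "j - i \<in> {0, 1, 2, 3, 4, 5, 6}" ..
  then show thesis
    using that by (auto simp: algebra_simps)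
qed

lemma R2_collapse [simp]: "R2 (r $ 1) (r $ 2) = r"
  by (simp add: vec_eq_iff forall_2)

lemma scaleR_R2 [simp]: "c *\<^sub>R R2 a b = R2 (c * a) (c * b)"
  by (simp add: vec_eq_iff forall_2)

lemma R2_add: "R2 a b + R2 a' b' = R2 (a + a') (b + b')"
  by (simp add: vec_eq_iff forall_2)

lemma R2_eq_0_iff [simp]: "R2 a b = 0 \<longleftrightarrow> a = 0 \<and> b = 0"
  by (simp add: vec_eq_iff forall_2)

lemma axis_scaleR: "axis i (c *\<^sub>R r) = c *\<^sub>R axis i r"
  by (simp add: vec_eq_iff axis_def)

lemma R2_axis: "axis 1 1 = R2 1 0" "axis 2 1 = R2 0 1"
  by (simp_all add: vec_eq_iff forall_2 axis_def)

section \<open>The Killing form on monomials\<close>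

lemma killing_eq_sum:
  "killing x y = (\<Sum>k\<in>UNIV. bracket x (bracket y (R2 1 0 \<cdot>g k)) $ k $ 1 + bracket x (bracket y (R2 0 1 \<cdot>g k)) $ k $ 2)"
proof -
  have "killing x y = (\<Sum>p\<in>UNIV \<times> UNIV. bracket x (bracket y (axis (fst p) (axis (snd p) 1))) $ fst p $ snd p)"
    by (simp add: killing_def trace_def endo_matrix_def ad_def)
  also have "\<dots> = (\<Sum>k\<in>UNIV. \<Sum>c\<in>UNIV. bracket x (bracket y (axis k (axis c 1))) $ k $ c)"
    by (simp add: sum.cartesian_product case_prod_unfold)
  finally show ?thesis
    by (simp add: sum_2 R2_axis)
qed

text \<open>The coefficients 4 and 12 explain the normalising factors \<open>1/2\<close> and
  \<open>1 / (2 * sqrt 3)\<close>. The absence of mixed terms makes the two basis elements at the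
  same index orthogonal.\<close>

lemma killing_same:
  "killing (R2 p q \<cdot>g i) (R2 a b \<cdot>g i) = - 4 * p * a - 12 * q * b"
proof -
  \<comment> \<open>The summation index is rewritten as an offset \<open>d\<close> from
    \<open>i\<close>, the form in which the table is stated.\<close>
  have "killing (R2 p q \<cdot>g i) (R2 a b \<cdot>g i) = (\<Sum>d\<in>UNIV.
     bracket (R2 p q \<cdot>g i) (bracket (R2 a b \<cdot>g i) (R2 1 0 \<cdot>g (i + d))) $ (i + d) $ 1 +
     bracket (R2 p q \<cdot>g i) (bracket (R2 a b \<cdot>g i) (R2 0 1 \<cdot>g (i + d))) $ (i + d) $ 2)"
    unfolding killing_eq_sum
    by (rule sum.reindex_bij_witness[of _ "\<lambda>d. i + d" "\<lambda>k. k - i"]) auto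
  also have "\<dots> = - 4 * p * a - 12 * q * b"
    unfolding UNIV_7 by (simp add: bracket_table bilinear_rzero[OF bilinear_bracket]) (simp add: field_simps)
  finally show ?thesis .
qed

lemma g_add_eq_0_iff: "g i + g j = 0 \<longleftrightarrow> i = j"
proof -
  have "\<forall>i j. g i + g j = 0 \<longleftrightarrow> i = j"
    unfolding forall_7 by (simp add: g_def vec_eq_iff forall_3)
  then show ?thesis by blast
qed

text \<open>This is the grading by the group. For \<open>i = j\<close> the degree would be 0, which
  is no value of \<open>g\<close>, but there the bracket vanishes; hence the alternative
  \<open>t = 0\<close>.\<close>

lemma bracket_monom_ex:
  "\<exists>t k. bracket (r \<cdot>g i) (s \<cdot>g j) = t \<cdot>g k \<and> (t = 0 \<or> g k = g i + g j)"
proof (cases "i = j")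
  case True
  then show ?thesis
    by (metis axis_eq_0_iff bracket_monom(1))
next
  case False
  have "g i + g j \<noteq> 0"
    using False g_add_eq_0_iff by blast
  then obtain k where "g k = g i + g j"
    using bij_g by (metis Diff_iff UNIV_I bij_betw_imp_surj_on imageE singletonD)
  then show ?thesis
    using False bracket_monom(2) by blast
qed

lemma killing_distinct:
  assumes "i \<noteq> j"
  shows "killing (r \<cdot>g i) (s \<cdot>g j) = 0"
proof -
  have "bracket (r \<cdot>g i) (bracket (s \<cdot>g j) (u \<cdot>g k)) $ k = 0" for u k
  proof -
    obtain t l where t: "bracket (s \<cdot>g j) (u \<cdot>g k) = t \<cdot>g l" "t = 0 \<or> g l = g j + g k"
      using bracket_monom_ex by metis
    obtain v m where v: "bracket (r \<cdot>g i) (t \<cdot>g l) = v \<cdot>g m" "v = 0 \<or> g m = g i + g l"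
      using bracket_monom_ex by metis
    \<comment> \<open>A nonzero diagonal entry needs nonzero coefficients and a double bracket that
      returns to degree \<open>g k\<close>; cancelling \<open>g k\<close> then contradicts
      \<open>i \<noteq> j\<close>.\<close>
    show ?thesis
    proof (cases "t = 0 \<or> v = 0 \<or> m \<noteq> k")
      case True
      then have "v = 0 \<or> m \<noteq> k"
        using v(1) axis_eq_0_iff by (metis bilinear_rzero[OF bilinear_bracket])
      then show ?thesis
        using t(1) v(1) by (auto simp: axis_def)
    next
      case False
      then have "g k = g i + (g j + g k)"
        using t v by auto
      then have "g i + g j = 0"
        by (metis add.assoc add_cancel_left_left)
      then show ?thesis
        using assms g_add_eq_0_iff by blast
    qed
  qed
  then show ?thesis
    by (simp add: killing_eq_sum)
qed

section \<open>Diagonalizability from an annihilating product of distinct linear factors\<close>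

text \<open>A basis can be selected from the spanning eigenvectors. Indexed by \<open>'n\<close>, it
  supplies the columns of the change of basis matrix \<open>Q\<close>.\<close>

lemma diagonalizable_if_span_eigenvectors:
  fixes A :: "'a::field^'n^'n"
  assumes "vec.span {v. \<exists>\<mu>. A *v v = \<mu> *s v} = UNIV"
  shows "diagonalizable A"
proof -
  obtain E where E: "E \<subseteq> {v. \<exists>\<mu>. A *v v = \<mu> *s v}" "vec.independent E"
      "{v. \<exists>\<mu>. A *v v = \<mu> *s v} \<subseteq> vec.span E"
    using vec.maximal_independent_subset by blast
  have spanE: "vec.span E = UNIV"
    using assms E(3) vec.span_minimal[OF _ vec.subspace_span] by blast
  then have "card E = CARD('n)"
    using vec.dim_eq_card[of E UNIV] E(2) vec_dim_card[where 'a='a and 'n='n] by (metis vec.span_UNIV)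
  moreover have "finite E"
    using E(2) vec.finiteI_independent by blast
  ultimately obtain f where f: "bij_betw f (UNIV :: 'n set) E"
    using finite_same_card_bij[of "UNIV :: 'n set" E] by auto
  have "\<forall>v\<in>E. \<exists>\<mu>. A *v v = \<mu> *s v"
    using E(1) by blast
  then obtain \<mu> where \<mu>: "\<forall>v\<in>E. A *v v = \<mu> v *s v"
    by (rule bchoice[THEN exE])
  define Q :: "'a^'n^'n" where "Q = (\<chi> r c. f c $ r)"
  define D :: "'a^'n^'n" where "D = (\<chi> r c. if r = c then \<mu> (f c) else 0)"
  have col: "column c Q = f c" for c
    by (simp add: Q_def column_def vec_eq_iff)
  then have "columns Q = E"
    using f by (auto simp: columns_def bij_betw_def)
  then have "\<exists>Q'. Q ** Q' = mat 1"
    using spanE by (simp add: matrix_right_invertible_span_columns)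
  then have inv: "invertible Q"
    by (simp add: invertible_right_inverse)
  \<comment> \<open>Column \<open>c\<close> of either product is
    \<open>\<mu> (f c) *s f c\<close>.\<close>
  have "A ** Q = Q ** D"
  proof -
    have "(A ** Q) $ r $ c = (Q ** D) $ r $ c" for r c
    proof -
      have "(A ** Q) $ r $ c = (A *v f c) $ r"
        by (simp add: matrix_matrix_mult_def matrix_vector_mult_def Q_def)
      also have "\<dots> = \<mu> (f c) * f c $ r"
        using \<mu> f by (simp add: bij_betw_apply)
      also have "\<dots> = (Q ** D) $ r $ c"
        by (simp add: matrix_matrix_mult_def Q_def D_def if_distrib cong: if_cong)
      finally show ?thesis .
    qed
    then show ?thesis by (simp add: vec_eq_iff)
  qed
  moreover have "Q ** matrix_inv Q = mat 1"
    using someI_ex[OF inv[unfolded invertible_def]] by (simp add: matrix_inv_def)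
  ultimately have "A = Q ** D ** matrix_inv Q"
    by (metis matrix_mul_assoc matrix_mul_rid)
  moreover have "\<forall>i j. i \<noteq> j \<longrightarrow> D $ i $ j = 0"
    by (simp add: D_def)
  ultimately show ?thesis
    using inv unfolding diagonalizable_def by blast
qed

text \<open>If \<open>A - \<mu>\<close> sends \<open>v\<close> to a combination of eigenvectors for
  other eigenvalues, then, being invertible on their span, it has the same value at some vector of
  that span; \<open>v\<close> differs from this vector by an element of the kernel of
  \<open>A - \<mu>\<close>.\<close>

lemma in_span_eigenvectors_if_annihilated:
  fixes A :: "'a::field^'n^'n"
  assumes "distinct \<mu>s" "foldr (\<lambda>\<mu> w. A *v w - \<mu> *s w) \<mu>s v = 0"
  shows "v \<in> vec.span {u. \<exists>\<mu>\<in>set \<mu>s. A *v u = \<mu> *s u}"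
  using assms
\<comment> \<open>\<open>foldr\<close> applies the last entry first. Induction on the reversed list
  removes this innermost factor, and the induction hypothesis is used at its value
  \<open>w\<close>.\<close>
proof (induction "rev \<mu>s" arbitrary: \<mu>s v)
  case Nil
  then show ?case by (simp add: vec.span_zero)
next
  case (Cons \<mu> \<nu>s')
  define \<nu>s where "\<nu>s = rev \<nu>s'"
  have \<mu>s: "\<mu>s = \<nu>s @ [\<mu>]"
    using Cons(2) by (metis \<nu>s_def rev.simps(2) rev_rev_ident)
  let ?S = "{u. \<exists>\<mu>\<in>set \<mu>s. A *v u = \<mu> *s u}"
  define w where "w = A *v v - \<mu> *s v"
  have "w \<in> vec.span {u. \<exists>\<mu>\<in>set \<nu>s. A *v u = \<mu> *s u}"
    using Cons(1)[of \<nu>s w] Cons(3,4) by (simp add: \<mu>s w_def \<nu>s_def)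
  \<comment> \<open>A preimage of \<open>w\<close> under \<open>A - \<mu>\<close> is assembled
    generator by generator.\<close>
  then have "\<exists>v'\<in>vec.span ?S. A *v v' - \<mu> *s v' = w"
  proof (induction rule: vec.span_induct_alt)
    case base
    then show ?case
      by (intro bexI[of _ 0]) (auto simp: vec.span_zero)
  next
    case (step c x y)
    then obtain \<nu> y' where \<nu>: "\<nu> \<in> set \<nu>s" "A *v x = \<nu> *s x"
      and y': "y' \<in> vec.span ?S" "A *v y' - \<mu> *s y' = y" by auto
    have "\<nu> \<noteq> \<mu>"
      using Cons(3) \<nu>(1) by (auto simp: \<mu>s)
    have "x \<in> ?S"
      using \<nu> by (auto simp: \<mu>s)
    \<comment> \<open>\<open>A - \<mu>\<close> multiplies the eigenvector \<open>x\<close> by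
      \<open>\<nu> - \<mu>\<close>, so \<open>d *s x\<close> is mapped to
      \<open>c *s x\<close>.\<close>
    define d where "d = c / (\<nu> - \<mu>)"
    have mem: "d *s x + y' \<in> vec.span ?S"
      using \<open>x \<in> ?S\<close> y'(1) by (intro vec.span_add vec.span_scale) (auto intro: vec.span_base)
    have "A *v (d *s x + y') - \<mu> *s (d *s x + y') = ((\<nu> - \<mu>) * d) *s x + y"
      unfolding y'(2)[symmetric] matrix_vector_right_distrib vector_scalar_commute \<nu>(2)
      by (simp add: vec_eq_iff algebra_simps)
    also have "(\<nu> - \<mu>) * d = c"
      using \<open>\<nu> \<noteq> \<mu>\<close> by (simp add: d_def)
    finally show ?case
      using mem by (rule bexI)
  qed
  then obtain v' where v': "v' \<in> vec.span ?S" "A *v v' - \<mu> *s v' = w" by blast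
  \<comment> \<open>\<open>v\<close> and \<open>v'\<close> have the same image \<open>w\<close>
    under \<open>A - \<mu>\<close>.\<close>
  have "A *v (v - v') = \<mu> *s (v - v')"
    using v'(2) by (simp add: w_def matrix_vector_mult_diff_distrib vec.scale_right_diff_distrib algebra_simps)
  then have "v - v' \<in> vec.span ?S"
    by (intro vec.span_base) (auto simp: \<mu>s)
  then have "(v - v') + v' \<in> vec.span ?S"
    using v'(1) vec.span_add by blast
  then show ?case by simp
qed

section \<open>Passage from a real endomorphism to its complex matrix\<close>

definition complexify :: "g2c \<Rightarrow> complex^(7 \<times> 2)" where
  "complexify v = (\<chi> p. complex_of_real (v $ fst p $ snd p))"

lemma complexify_linear:
  "complexify (x + y) = complexify x + complexify y"
  "complexify (c *\<^sub>R x) = complex_of_real c *s complexify x"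
  "complexify 0 = 0"
  by (simp_all add: complexify_def vec_eq_iff)

lemma g2c_expansion: "v = (\<Sum>p\<in>UNIV. (v $ fst p $ snd p) *\<^sub>R axis (fst p) (axis (snd p) 1))" for v :: g2c
proof -
  have "(\<Sum>p\<in>UNIV. (v $ fst p $ snd p) *\<^sub>R axis (fst p) (axis (snd p) 1)) $ k $ c = v $ k $ c" for k c
  proof -
    have "(\<Sum>p\<in>UNIV. (v $ fst p $ snd p) *\<^sub>R axis (fst p) (axis (snd p) 1)) $ k $ c
      = (\<Sum>p\<in>UNIV. if p = (k, c) then v $ k $ c else 0)"
      unfolding sum_component by (rule sum.cong) (auto simp: axis_def)
    then show ?thesis by simp
  qed
  then show ?thesis by (simp add: vec_eq_iff)
qed

text \<open>Iterates of the complex matrix on real vectors can thus be computed with the real map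
  \<open>f\<close>, to which the table applies.\<close>

lemma endo_matrix_complexify:
  assumes "linear f"
  shows "(\<chi> p q. complex_of_real (endo_matrix f $ p $ q)) *v complexify v = complexify (f v)"
proof -
  have "f v = (\<Sum>p\<in>UNIV. (v $ fst p $ snd p) *\<^sub>R f (axis (fst p) (axis (snd p) 1)))"
    by (subst g2c_expansion[of v]) (simp add: linear_sum[OF assms] linear_scale[OF assms])
  then have "f v $ k $ c = (\<Sum>p\<in>UNIV. (v $ fst p $ snd p) * f (axis (fst p) (axis (snd p) 1)) $ k $ c)" for k c
    by simp
  then show ?thesis
    by (simp add: vec_eq_iff matrix_vector_mult_def complexify_def endo_matrix_def mult.commute)
qed

text \<open>The conjugate roots are paired into real quadratic factors, so the hypothesis is a real
  computation. Checking it on monomials suffices because they include a basis.\<close>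

lemma diagonalizable_if_annihilated:
  fixes f :: "g2c \<Rightarrow> g2c"
  assumes f: "linear f" and "c \<noteq> 0"
    and ann: "\<And>k r. (let y1 = f (f (r \<cdot>g k)) + ((3*c/2)\<^sup>2) *\<^sub>R (r \<cdot>g k); y2 = f (f y1) + (c\<^sup>2) *\<^sub>R y1;
       y3 = f (f y2) + ((c/2)\<^sup>2) *\<^sub>R y2 in f y3) = 0"
  shows "diagonalizable ((\<chi> p q. complex_of_real (endo_matrix f $ p $ q)) :: complex^(7 \<times> 2)^(7 \<times> 2))"
    (is "diagonalizable ?A")
proof -
  note A = endo_matrix_complexify[OF f]
  \<comment> \<open>The factors for \<open>\<mu>\<close> and \<open>- \<mu>\<close> merge into
    \<open>T^2 - \<mu>^2 = T^2 + d^2\<close>.\<close>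
  have sq: "?A *v (?A *v complexify y - (- \<mu>) *s complexify y) - \<mu> *s (?A *v complexify y - (- \<mu>) *s complexify y)
      = complexify (f (f y) + (d\<^sup>2) *\<^sub>R y)" if "\<mu> = \<i> * complex_of_real d" for d \<mu> y
  proof -
    have "?A *v (?A *v complexify y - (- \<mu>) *s complexify y) - \<mu> *s (?A *v complexify y - (- \<mu>) *s complexify y)
      = ?A *v (?A *v complexify y) - (\<mu>\<^sup>2) *s complexify y"
      by (simp add: matrix_vector_right_distrib vector_scalar_commute vec_eq_iff algebra_simps power2_eq_square)
    then show ?thesis
      by (simp add: A complexify_linear that power_mult_distrib)
  qed
  let ?z = "\<lambda>d. \<i> * complex_of_real d"
  \<comment> \<open>The order matters: \<open>foldr\<close> starts at the right end, so the roots
    with \<open>3*c/2\<close> act first, as in \<open>y1\<close>, and the root 0 acts last.\<close>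
  let ?\<mu>s = "[0, ?z (c/2), - ?z (c/2), ?z c, - ?z c, ?z (3*c/2), - ?z (3*c/2)]"
  have dist: "distinct ?\<mu>s"
    using \<open>c \<noteq> 0\<close> by (simp add: complex_eq_iff)
  have "axis p 1 \<in> vec.span {v. \<exists>\<mu>. ?A *v v = \<mu> *s v}" for p
  proof -
    have e: "axis p 1 = complexify (axis (snd p) 1 \<cdot>g fst p)"
      by (auto simp: complexify_def vec_eq_iff axis_def prod_eq_iff)
    have "foldr (\<lambda>\<mu> w. ?A *v w - \<mu> *s w) ?\<mu>s (complexify (axis (snd p) 1 \<cdot>g fst p)) = 0"
      unfolding foldr.simps comp_def id_def sq[OF refl] unfolding A
      using ann[of "fst p" "axis (snd p) 1"]
      by (simp add: complexify_linear(3) Let_def)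
    then have "axis p 1 \<in> vec.span {v. \<exists>\<mu>\<in>set ?\<mu>s. ?A *v v = \<mu> *s v}"
      unfolding e by (rule in_span_eigenvectors_if_annihilated[OF dist])
    then show ?thesis
      by (rule rev_subsetD[OF _ vec.span_mono]) blast
  qed
  then have "cart_basis \<subseteq> vec.span {v. \<exists>\<mu>. ?A *v v = \<mu> *s v}"
    by (auto simp: cart_basis_def)
  then have "vec.span {v. \<exists>\<mu>. ?A *v v = \<mu> *s v} = UNIV"
    using vec.span_minimal[OF _ vec.subspace_span] vec.span_Basis by blast
  then show ?thesis
    by (rule diagonalizable_if_span_eigenvectors)
qed

section \<open>Rescaled bases: semisimplicity, orthogonality, integrality\<close>

text \<open>Both bases of the theorem are instances: \<open>(s, t)\<close> is \<open>(4, 4)\<close>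
  for the first and \<open>(1/2, 1 / (2 * sqrt 3))\<close> for the second.\<close>

definition scaled_basis :: "real \<Rightarrow> real \<Rightarrow> g2c set" where
  "scaled_basis s t = range (\<lambda>i. R2 s 0 \<cdot>g i) \<union> range (\<lambda>i. R2 0 t \<cdot>g i)"

text \<open>One polynomial serves both columns: for \<open>(c,0)\<close> the nonzero eigenvalues are
  \<open>\<plusminus> i c/2\<close> and \<open>\<plusminus> i c\<close>, and for
  \<open>(0,c)\<close> also \<open>\<plusminus> 3 i c/2\<close> occurs.\<close>

lemma semisimple_monom:
  assumes "p = 0 \<and> q \<noteq> 0 \<or> p \<noteq> 0 \<and> q = 0"
  shows "semisimple (R2 p q \<cdot>g i)"
proof -
  \<comment> \<open>This is whichever of \<open>p\<close> and \<open>q\<close> is nonzero.\<close>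
  define c where "c = p + q"
  have lin: "linear (ad (R2 p q \<cdot>g i))"
    using bilinear_bracket by (simp add: ad_def bilinear_def)
  \<comment> \<open>Merging terms with the same index keeps each intermediate result a single
    monomial, so the next bracket again matches the table.\<close>
  have pull: "axis k x + axis k y = axis k (x + y)" "a *\<^sub>R axis k x = axis k (a *\<^sub>R x)"
    for k :: 7 and x y :: R and a
    by (simp_all add: vec_eq_iff axis_def)
  have ann: "(let y1 = ad x (ad x (r \<cdot>g k)) + ((3*c/2)\<^sup>2) *\<^sub>R (r \<cdot>g k); y2 = ad x (ad x y1) + (c\<^sup>2) *\<^sub>R y1;
       y3 = ad x (ad x y2) + ((c/2)\<^sup>2) *\<^sub>R y2 in ad x y3) = 0" if "x = R2 p q \<cdot>g i" for x k r
  proof -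
    have "r = R2 (r $ 1) (r $ 2)" by simp
    then obtain a b where r: "r = R2 a b" by blast
    show ?thesis
      using assms unfolding r that ad_def Let_def
      by (rule disjE; cases rule: index_shift_cases[of k i])
         (simp_all add: bracket_table bilinear_rzero[OF bilinear_bracket] pull R2_add c_def, simp_all add: field_simps power2_eq_square)
  qed
  show ?thesis
    unfolding semisimple_def
    by (rule diagonalizable_if_annihilated[OF lin _ ann[OF refl]]) (use assms c_def in auto)
qed

lemma Basis_eq_scaled_basis: "(Basis :: g2c set) = scaled_basis 1 1"
proof -
  have "(Basis :: R set) = {R2 1 0, R2 0 1}"
    by (auto simp: Basis_vec_def UNIV_2 R2_axis)
  then show ?thesis
    by (auto simp: Basis_vec_def scaled_basis_def)
qed

lemma scaled_basis_elem:
  assumes "x \<in> scaled_basis s t"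
  obtains u b where "u \<in> {s, t}" "b \<in> scaled_basis 1 1" "x = u *\<^sub>R b"
proof -
  have "R2 s 0 \<cdot>g i = s *\<^sub>R (R2 1 0 \<cdot>g i)" "R2 0 t \<cdot>g i = t *\<^sub>R (R2 0 1 \<cdot>g i)" for i
    by (simp_all flip: axis_scaleR)
  then show thesis
    using assms that unfolding scaled_basis_def by blast
qed

lemma inner_R2: "R2 p q \<bullet> R2 a b = p * a + q * b"
  by (simp add: inner_vec_def sum_2)

text \<open>Orthogonality for the Euclidean inner product, as opposed to the Killing form; it gives
  linear independence and a formula for coordinates.\<close>

lemma scaled_basis_orthogonal:
  assumes "x \<in> scaled_basis s t" "y \<in> scaled_basis s t" "x \<noteq> y"
  shows "x \<bullet> y = 0"
  using assms by (auto simp: scaled_basis_def inner_axis_axis inner_R2)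

lemma killing_orthogonal_scaled: "pairwise (\<lambda>x y. killing x y = 0) (scaled_basis s t)"
proof -
  \<comment> \<open>This covers one element from each family at arbitrary indices; two elements of
    the same family are treated next.\<close>
  have "killing (R2 p q \<cdot>g i) (R2 a b \<cdot>g j) = 0" if "p = 0 \<or> a = 0" "q = 0 \<or> b = 0" for p q a b i j
    using that by (cases "i = j") (auto simp: killing_same killing_distinct)
  moreover have "killing (r \<cdot>g i) (r \<cdot>g j) = 0" if "r \<cdot>g i \<noteq> r \<cdot>g j" for r i j
  proof -
    have "i \<noteq> j" using that by auto
    then show ?thesis by (rule killing_distinct)
  qed
  ultimately show ?thesis
    unfolding pairwise_def scaled_basis_def by blast
qed

text \<open>The only denominator in the table is 4, and its numerators are integral in
  \<open>p\<close>, \<open>q\<close>, \<open>a\<close>, \<open>b\<close>.\<close>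

lemma bracket_Basis_integral:
  assumes "x \<in> scaled_basis 1 1" "y \<in> scaled_basis 1 1" "z \<in> Basis"
  shows "4 * (bracket x y \<bullet> z) \<in> \<int>"
proof -
  have "4 * bracket (R2 p q \<cdot>g i) (R2 a b \<cdot>g j) $ k $ 1 \<in> \<int> \<and>
      4 * bracket (R2 p q \<cdot>g i) (R2 a b \<cdot>g j) $ k $ 2 \<in> \<int>"
    if "p \<in> \<int>" "q \<in> \<int>" "a \<in> \<int>" "b \<in> \<int>" for p q a b i j k
    using that
    by (cases rule: index_shift_cases[of j i]) (simp_all add: bracket_table, simp_all add: axis_def add_divide_distrib)
  then have "4 * bracket x y $ k $ c \<in> \<int>" for k c
    using assms(1,2) exhaust_2[of c] by (auto simp: scaled_basis_def)
  moreover obtain k c where "z = axis k (axis c 1)"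
    using assms(3) by (auto simp: Basis_vec_def)
  ultimately show ?thesis
    by (simp add: inner_axis)
qed

section \<open>Coordinates and structure constants in a rescaled basis\<close>

context
  fixes s t :: real
  assumes st: "s \<noteq> 0" "t \<noteq> 0"
begin

lemma is_basis_scaled: "is_basis (scaled_basis s t)"
  unfolding is_basis_def
proof
  show "independent (scaled_basis s t)"
  proof (rule pairwise_orthogonal_independent)
    show "pairwise orthogonal (scaled_basis s t)"
      by (simp add: pairwise_def orthogonal_def scaled_basis_orthogonal)
    show "0 \<notin> scaled_basis s t"
      using st by (auto simp: scaled_basis_def)
  qed
  have "b \<in> span (scaled_basis s t)" if "b \<in> Basis" for b
  proof -
    have "R2 1 0 \<cdot>g i = (1/s) *\<^sub>R (R2 s 0 \<cdot>g i)" "R2 0 1 \<cdot>g i = (1/t) *\<^sub>R (R2 0 t \<cdot>g i)" for i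
      using st by (simp_all flip: axis_scaleR)
    then have "b \<in> (*\<^sub>R) (1/s) ` scaled_basis s t \<union> (*\<^sub>R) (1/t) ` scaled_basis s t"
      using that unfolding Basis_eq_scaled_basis by (auto simp: scaled_basis_def)
    then show ?thesis
      by (auto intro: span_base span_scale)
  qed
  then show "span (scaled_basis s t) = UNIV"
    by (metis span_Basis span_minimal subsetI subspace_span top.extremum_uniqueI)
qed

text \<open>Pairing the expansion of \<open>v\<close> with \<open>u *\<^sub>R b\<close> leaves one
  term by orthogonality. Its weight is \<open>u * u\<close>, since \<open>b\<close> is a unit
  vector, and one factor \<open>u\<close> cancels.\<close>

lemma representation_scaled:
  assumes "u *\<^sub>R b \<in> scaled_basis s t" "b \<in> Basis" "u \<noteq> 0"
  shows "representation (scaled_basis s t) v (u *\<^sub>R b) = (v \<bullet> b) / u"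
proof -
  let ?B = "scaled_basis s t"
  let ?r = "representation ?B v"
  have ind: "independent ?B" and span: "span ?B = UNIV"
    using is_basis_scaled by (auto simp: is_basis_def)
  have fin: "finite ?B"
    by (simp add: scaled_basis_def)
  have orth: "w \<bullet> (u *\<^sub>R b) = 0" if "w \<in> ?B" "w \<noteq> u *\<^sub>R b" for w
    by (rule scaled_basis_orthogonal[OF that(1) assms(1) that(2)])
  have "v \<bullet> (u *\<^sub>R b) = (\<Sum>w\<in>?B. ?r w *\<^sub>R w) \<bullet> (u *\<^sub>R b)"
    using sum_representation_eq[OF ind _ fin order_refl, of v] span by simp
  also have "\<dots> = (\<Sum>w\<in>?B. if w = u *\<^sub>R b then ?r w * (w \<bullet> (u *\<^sub>R b)) else 0)"
    unfolding inner_sum_left by (rule sum.cong) (auto simp: orth simp del: inner_scaleR_right)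
  also have "\<dots> = ?r (u *\<^sub>R b) * (u * u)"
    using assms fin by simp
  finally show ?thesis
    using assms by (simp add: field_simps)
qed

lemma semisimple_scaled: "x \<in> scaled_basis s t \<Longrightarrow> semisimple x"
  using st by (auto simp: scaled_basis_def intro: semisimple_monom)

text \<open>Rescaling the three basis vectors by \<open>u\<close>, \<open>v\<close>,
  \<open>w\<close> multiplies a structure constant \<open>m\<close> of
  \<open>scaled_basis 1 1\<close> by \<open>u * v / w\<close>.\<close>

lemma structure_constants_scaled:
  "structure_constants (scaled_basis s t) \<subseteq>
     {u * v / w * m | u v w m. u \<in> {s, t} \<and> v \<in> {s, t} \<and> w \<in> {s, t} \<and> 4 * m \<in> \<int>}"
proof
  fix r assume "r \<in> structure_constants (scaled_basis s t)"
  then obtain x y z where r: "r = representation (scaled_basis s t) (bracket x y) z"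
    and xyz: "x \<in> scaled_basis s t" "y \<in> scaled_basis s t" "z \<in> scaled_basis s t"
    by (auto simp: structure_constants_def)
  obtain u b where x: "u \<in> {s, t}" "b \<in> scaled_basis 1 1" "x = u *\<^sub>R b"
    using scaled_basis_elem[OF xyz(1)] .
  obtain v b' where y: "v \<in> {s, t}" "b' \<in> scaled_basis 1 1" "y = v *\<^sub>R b'"
    using scaled_basis_elem[OF xyz(2)] .
  obtain w b'' where z: "w \<in> {s, t}" "b'' \<in> scaled_basis 1 1" "z = w *\<^sub>R b''"
    using scaled_basis_elem[OF xyz(3)] .
  have "b'' \<in> Basis" "w \<noteq> 0"
    using z st by (auto simp: Basis_eq_scaled_basis)
  then have "r = (bracket x y \<bullet> b'') / w"
    using r xyz(3) representation_scaled z(3) by blast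
  also have "bracket x y = (u * v) *\<^sub>R bracket b b'"
    unfolding x(3) y(3)
    by (simp add: bilinear_lmul[OF bilinear_bracket] bilinear_rmul[OF bilinear_bracket])
  finally have "r = u * v / w * (bracket b b' \<bullet> b'')"
    by simp
  moreover have "4 * (bracket b b' \<bullet> b'') \<in> \<int>"
    using bracket_Basis_integral x(2) y(2) \<open>b'' \<in> Basis\<close> by blast
  ultimately show "r \<in> {u * v / w * m | u v w m. u \<in> {s, t} \<and> v \<in> {s, t} \<and> w \<in> {s, t} \<and> 4 * m \<in> \<int>}"
    using x(1) y(1) z(1) by blast
qed

end

section \<open>Arithmetic in the rationals with the square root of 3 adjoined\<close>

lemma Rats_sqrt3_mult:
  assumes "x \<in> Rats_sqrt3" "y \<in> Rats_sqrt3"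
  shows "x * y \<in> Rats_sqrt3"
proof -
  obtain p q p' q' where x: "x = p + q * sqrt 3" "y = p' + q' * sqrt 3"
    and rat: "p \<in> \<rat>" "q \<in> \<rat>" "p' \<in> \<rat>" "q' \<in> \<rat>"
    using assms by (auto simp: Rats_sqrt3_def)
  have "x * y = (p * p' + 3 * q * q') + (p * q' + q * p') * sqrt 3"
    by (simp add: x algebra_simps)
  moreover have "p * p' + 3 * q * q' \<in> \<rat>" "p * q' + q * p' \<in> \<rat>"
    using rat by simp_all
  ultimately show ?thesis
    unfolding Rats_sqrt3_def by blast
qed

lemma Rats_sqrt3_rat_multiples:
  assumes "q \<in> \<rat>"
  shows "q \<in> Rats_sqrt3" "q * sqrt 3 \<in> Rats_sqrt3"
proof -
  have "q = q + 0 * sqrt 3" "q * sqrt 3 = 0 + q * sqrt 3"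
    by simp_all
  then show "q \<in> Rats_sqrt3" "q * sqrt 3 \<in> Rats_sqrt3"
    using assms Rats_0 unfolding Rats_sqrt3_def by blast+
qed

theorem corollary2:
  fixes B C :: "g2c set"
  assumes B: "B = range (\<lambda>i. R2 4 0 \<cdot>g i) \<union> range (\<lambda>i. R2 0 4 \<cdot>g i)"
    and C: "C = range (\<lambda>i. ((1/2) *\<^sub>R R2 1 0) \<cdot>g i)
              \<union> range (\<lambda>i. ((1 / (2 * sqrt 3)) *\<^sub>R R2 0 1) \<cdot>g i)"
  shows
    "(is_basis B \<and> pairwise (\<lambda>x y. killing x y = 0) B \<and> (\<forall>x\<in>B. semisimple x)
        \<and> structure_constants B \<subseteq> \<int>) \<and>
     (\<forall>i a b.
        ad (R2 1 0 \<cdot>g i) (R2 a b \<cdot>g i) = 0 \<and>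
        ad (R2 0 1 \<cdot>g i) (R2 a b \<cdot>g i) = 0 \<and>
        ad (R2 1 0 \<cdot>g i) (R2 a b \<cdot>g (i + 1)) = ((1/4) *\<^sub>R R2 (a + 3 * b) (- a - 3 * b)) \<cdot>g (i + 3) \<and>
        ad (R2 0 1 \<cdot>g i) (R2 a b \<cdot>g (i + 1)) = ((1/4) *\<^sub>R R2 (3 * b - 3 * a) (b - a)) \<cdot>g (i + 3) \<and>
        ad (R2 1 0 \<cdot>g i) (R2 a b \<cdot>g (i + 2)) = ((1/4) *\<^sub>R R2 (a - 3 * b) (- a - b)) \<cdot>g (i + 6) \<and>
        ad (R2 0 1 \<cdot>g i) (R2 a b \<cdot>g (i + 2)) = ((1/4) *\<^sub>R R2 (3 * a - 9 * b) (a + b)) \<cdot>g (i + 6) \<and>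
        ad (R2 1 0 \<cdot>g i) (R2 a b \<cdot>g (i + 3)) = ((1/4) *\<^sub>R R2 (3 * b - a) (3 * b - a)) \<cdot>g (i + 1) \<and>
        ad (R2 0 1 \<cdot>g i) (R2 a b \<cdot>g (i + 3)) = ((1/4) *\<^sub>R R2 (3 * a + 3 * b) (- a - b)) \<cdot>g (i + 1) \<and>
        ad (R2 1 0 \<cdot>g i) (R2 a b \<cdot>g (i + 4)) = ((1/4) *\<^sub>R R2 (a - 3 * b) (a + b)) \<cdot>g (i + 5) \<and>
        ad (R2 0 1 \<cdot>g i) (R2 a b \<cdot>g (i + 4)) = ((1/4) *\<^sub>R R2 (- 3 * a - 3 * b) (b - 3 * a)) \<cdot>g (i + 5) \<and>
        ad (R2 1 0 \<cdot>g i) (R2 a b \<cdot>g (i + 5)) = ((1/4) *\<^sub>R R2 (- a - 3 * b) (a - b)) \<cdot>g (i + 4) \<and>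
        ad (R2 0 1 \<cdot>g i) (R2 a b \<cdot>g (i + 5)) = ((1/4) *\<^sub>R R2 (3 * a + 9 * b) (a - b)) \<cdot>g (i + 4) \<and>
        ad (R2 1 0 \<cdot>g i) (R2 a b \<cdot>g (i + 6)) = ((1/4) *\<^sub>R R2 (3 * b - a) (a + b)) \<cdot>g (i + 2) \<and>
        ad (R2 0 1 \<cdot>g i) (R2 a b \<cdot>g (i + 6)) = ((1/4) *\<^sub>R R2 (- 3 * a - 3 * b) (3 * a - b)) \<cdot>g (i + 2)) \<and>
     (is_basis C \<and> pairwise (\<lambda>x y. killing x y = 0) C \<and> (\<forall>x\<in>C. killing x x = - 1)
        \<and> (\<forall>x\<in>C. semisimple x) \<and> structure_constants C \<subseteq> Rats_sqrt3)"
  (is "?basisB \<and> ?table \<and> ?basisC")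
proof (intro conjI)
  let ?t = "1 / (2 * sqrt 3)"
  have B': "B = scaled_basis 4 4"
    by (simp add: B scaled_basis_def)
  have C': "C = scaled_basis (1/2) ?t"
    by (simp add: C scaled_basis_def)
  show "is_basis B" "pairwise (\<lambda>x y. killing x y = 0) B" "\<forall>x\<in>B. semisimple x"
    unfolding B' by (auto intro!: is_basis_scaled killing_orthogonal_scaled elim!: semisimple_scaled[rotated 2])
  \<comment> \<open>Here \<open>u * v / w = 4\<close>, which clears the denominator of
    \<open>m\<close>.\<close>
  show "structure_constants B \<subseteq> \<int>"
    unfolding B' using structure_constants_scaled[of 4 4] by auto
  show ?table
    unfolding ad_def by (simp add: bracket_table)
  show "is_basis C" "pairwise (\<lambda>x y. killing x y = 0) C" "\<forall>x\<in>C. semisimple x"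
    unfolding C' by (auto intro!: is_basis_scaled killing_orthogonal_scaled elim!: semisimple_scaled[rotated 2])
  \<comment> \<open>The norms are \<open>- 4 * (1/2)^2\<close> and
    \<open>- 12 / (2 * sqrt 3)^2\<close>.\<close>
  show "\<forall>x\<in>C. killing x x = - 1"
    unfolding C' by (auto simp: scaled_basis_def killing_same)
  show "structure_constants C \<subseteq> Rats_sqrt3"
  proof
    fix r assume "r \<in> structure_constants C"
    then have "r \<in> {u * v / w * m | u v w m. u \<in> {1/2, ?t} \<and> v \<in> {1/2, ?t} \<and> w \<in> {1/2, ?t} \<and> 4 * m \<in> \<int>}"
      unfolding C' by (rule rev_subsetD[OF _ structure_constants_scaled]) simp_all
    then obtain u v w m where r: "r = u * v / w * m" "4 * m \<in> \<int>"
      and uvw: "u \<in> {1/2, ?t}" "v \<in> {1/2, ?t}" "w \<in> {1/2, ?t}"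
      by blast
    \<comment> \<open>Division by \<open>w\<close> is handled by showing that both scaling factors
      and their inverses are rational or rational multiples of \<open>sqrt 3\<close>; closure under
      products then suffices.\<close>
    have t: "?t = (1/6) * sqrt 3" "inverse ?t = 2 * sqrt 3"
      by (simp_all add: field_simps)
    have "4 * m / 4 \<in> \<rat>"
      using r(2) Ints_subset_Rats by (intro Rats_divide) auto
    then have "m \<in> Rats_sqrt3"
      using Rats_sqrt3_rat_multiples(1) by simp
    moreover have "?t \<in> Rats_sqrt3"
      unfolding t(1) by (rule Rats_sqrt3_rat_multiples) simp
    moreover have "inverse ?t \<in> Rats_sqrt3"
      unfolding t(2) by (rule Rats_sqrt3_rat_multiples) simp
    moreover have "1/2 \<in> Rats_sqrt3" "inverse (1/2) \<in> Rats_sqrt3"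
      by (simp_all add: Rats_sqrt3_rat_multiples(1))
    ultimately have "u \<in> Rats_sqrt3" "v \<in> Rats_sqrt3" "inverse w \<in> Rats_sqrt3" "m \<in> Rats_sqrt3"
      using uvw by blast+
    then show "r \<in> Rats_sqrt3"
      unfolding r(1) divide_inverse by (intro Rats_sqrt3_mult)
  qed
qed

end
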